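(* Let $\kappa$ be a cardinal and $U$ an ultrafilter over $\kappa$. Every open subset of ${}^{\omega}\kappa$ is $U$-measurable.
   Context: ${}^{\omega}\kappa$ carries the product topology of the discrete space $\kappa$. ${}^{<\omega}\kappa$ is the set of finite sequences from $\kappa$; $\frown$ is concatenation, $\langle\rangle$ the empty sequence. A tree is a subset of ${}^{<\omega}\kappa$ closed under initial segments; $[T]$ is the set of infinite branches of $T$. For $X\subseteq{}^{\omega}\kappa$ and $\sigma\in{}^{<\omega}\kappa$, $X\lfloor\sigma=\{s:\sigma\frown s\in X\}$. A tree $T$ is $U$-branching iff $\langle\rangle\in T$ and for each $\sigma\in T$, $\{\alpha\in\kappa:\sigma\frown\langle\alpha\rangle\in T\}\in U$. $X$ is $U$-large (resp. $U$-small) iff there is a $U$-branching tree $T$ with $[T]\subseteq X$ (resp. $[T]\cap X=\emptyset$); $X$ is $U$-determined iff it is $U$-large or $U$-small; $X$ is $U$-measurable iff $X\lfloor\sigma$ is $U$-determined for every $\sigma\in{}^{<\omega}\kappa$. *)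

theory Defs
  imports "HOL-Analysis.Analysis" "HOL-Library.Omega_Words_Fun" "HOL-Library.Sublist"
begin

text \<open>
  Throughout, \<open>K\<close> is the underlying set of the cardinal \<open>\<kappa>\<close>, finite sequences from \<open>\<kappa>\<close> are the
  elements of \<open>lists K\<close>, and infinite ones are functions \<open>nat \<Rightarrow> 'a\<close> with values in \<open>K\<close>.
  The operator \<open>\<frown>\<close> from \<open>Omega_Words_Fun\<close> prepends a finite sequence to an infinite one.
\<close>

definition ultrafilter_over :: "'a set \<Rightarrow> 'a set set \<Rightarrow> bool" where
  "ultrafilter_over K U \<longleftrightarrow>
     U \<subseteq> Pow K \<and> K \<in> U \<and> {} \<notin> U \<and>
     (\<forall>A\<in>U. \<forall>B\<in>U. A \<inter> B \<in> U) \<and>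
     (\<forall>A\<in>U. \<forall>B. A \<subseteq> B \<and> B \<subseteq> K \<longrightarrow> B \<in> U) \<and>
     (\<forall>A. A \<subseteq> K \<longrightarrow> A \<in> U \<or> K - A \<in> U)"

definition seq_topology :: "'a set \<Rightarrow> (nat \<Rightarrow> 'a) topology" where
  "seq_topology K = product_topology (\<lambda>_. discrete_topology K) UNIV"

definition seq_tree :: "'a set \<Rightarrow> 'a list set \<Rightarrow> bool" where
  "seq_tree K T \<longleftrightarrow> T \<subseteq> lists K \<and> (\<forall>\<sigma>\<in>T. \<forall>\<tau>. Sublist.prefix \<tau> \<sigma> \<longrightarrow> \<tau> \<in> T)"

definition branches :: "'a set \<Rightarrow> 'a list set \<Rightarrow> (nat \<Rightarrow> 'a) set" where
  "branches K T = {s \<in> UNIV \<rightarrow> K. \<forall>n. map s [0..<n] \<in> T}"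

definition seq_shift :: "'a set \<Rightarrow> (nat \<Rightarrow> 'a) set \<Rightarrow> 'a list \<Rightarrow> (nat \<Rightarrow> 'a) set" where
  "seq_shift K X \<sigma> = {s \<in> UNIV \<rightarrow> K. \<sigma> \<frown> s \<in> X}"

definition U_branching :: "'a set \<Rightarrow> 'a set set \<Rightarrow> 'a list set \<Rightarrow> bool" where
  "U_branching K U T \<longleftrightarrow>
     seq_tree K T \<and> [] \<in> T \<and> (\<forall>\<sigma>\<in>T. {\<alpha> \<in> K. \<sigma> @ [\<alpha>] \<in> T} \<in> U)"

definition U_large :: "'a set \<Rightarrow> 'a set set \<Rightarrow> (nat \<Rightarrow> 'a) set \<Rightarrow> bool" where
  "U_large K U X \<longleftrightarrow> (\<exists>T. U_branching K U T \<and> branches K T \<subseteq> X)"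

definition U_small :: "'a set \<Rightarrow> 'a set set \<Rightarrow> (nat \<Rightarrow> 'a) set \<Rightarrow> bool" where
  "U_small K U X \<longleftrightarrow> (\<exists>T. U_branching K U T \<and> branches K T \<inter> X = {})"

definition U_determined :: "'a set \<Rightarrow> 'a set set \<Rightarrow> (nat \<Rightarrow> 'a) set \<Rightarrow> bool" where
  "U_determined K U X \<longleftrightarrow> U_large K U X \<or> U_small K U X"

definition U_measurable :: "'a set \<Rightarrow> 'a set set \<Rightarrow> (nat \<Rightarrow> 'a) set \<Rightarrow> bool" where
  "U_measurable K U X \<longleftrightarrow> (\<forall>\<sigma>\<in>lists K. U_determined K U (seq_shift K X \<sigma>))"

end

theory Submission
  imports Defs
begin

text \<open>
  If \<open>U\<close>-many one-step shifts of \<open>Y\<close> are \<open>U\<close>-large, gluing the witnessing trees shows that \<open>Y\<close> is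
  \<open>U\<close>-large. Hence, as \<open>U\<close> is an ultrafilter, if \<open>Y\<close> is not \<open>U\<close>-large then \<open>U\<close>-many of its
  one-step shifts are not, and the finite sequences all of whose initial segments \<open>\<rho>\<close> have a shift
  of \<open>Y\<close> by \<open>\<rho>\<close> that is not \<open>U\<close>-large form a \<open>U\<close>-branching tree. When \<open>Y\<close> is open, no branch of
  this tree lies in \<open>Y\<close>: some initial segment of such a branch would have all its extensions in
  \<open>Y\<close>, so the corresponding shift would be the whole space, which is \<open>U\<close>-large.
\<close>

lemma seq_shift_Nil: "Y \<subseteq> UNIV \<rightarrow> K \<Longrightarrow> seq_shift K Y [] = Y"
  by (auto simp: seq_shift_def)

lemma conc_in_funcset: "\<sigma> \<in> lists K \<Longrightarrow> s \<in> UNIV \<rightarrow> K \<Longrightarrow> \<sigma> \<frown> s \<in> UNIV \<rightarrow> K"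
  by (auto simp: conc_def in_lists_conv_set)

lemma seq_shift_append:
  "\<tau> \<in> lists K \<Longrightarrow> seq_shift K X (\<sigma> @ \<tau>) = seq_shift K (seq_shift K X \<sigma>) \<tau>"
  using conc_in_funcset[of \<tau> K] by (auto simp: seq_shift_def)

text \<open>A basic open box around \<open>s\<close> restricts only finitely many coordinates, so
  any strict bound \<open>n\<close> on these works: beyond it every value in \<open>K\<close> is
  allowed.\<close>

lemma openin_seq_topology_imp_cylinder:
  assumes "openin (seq_topology K) X" "s \<in> X"
  obtains n where "\<And>t. t \<in> UNIV \<rightarrow> K \<Longrightarrow> (\<And>i. i < n \<Longrightarrow> t i = s i) \<Longrightarrow> t \<in> X"
proof -
  obtain V where V: "finite {i. V i \<noteq> K}" "\<And>i. s i \<in> V i" "Pi\<^sub>E UNIV V \<subseteq> X"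
    using assms unfolding seq_topology_def openin_product_topology_alt by force
  obtain n where n: "\<And>i. V i \<noteq> K \<Longrightarrow> i < n"
    using finite_nat_set_iff_bounded V(1) by auto
  have "t \<in> X" if "t \<in> UNIV \<rightarrow> K" "\<And>i. i < n \<Longrightarrow> t i = s i" for t
  proof -
    have "t i \<in> V i" for i
      using that n[of i] V(2)[of i] by (cases "V i = K") auto
    then show ?thesis
      using V(3) by (auto simp: PiE_iff)
  qed
  then show thesis
    by (rule that)
qed

lemma U_branching_lists:
  assumes "K \<in> U"
  shows "U_branching K U (lists K)"
proof -
  have "{\<alpha> \<in> K. \<sigma> @ [\<alpha>] \<in> lists K} = K" if "\<sigma> \<in> lists K" for \<sigma>
    using that by auto
  moreover have "seq_tree K (lists K)"
    unfolding seq_tree_def in_lists_conv_set by (blast dest: set_mono_prefix)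
  ultimately show ?thesis
    using assms by (simp add: U_branching_def)
qed

lemma U_large_space: "K \<in> U \<Longrightarrow> U_large K U (UNIV \<rightarrow> K)"
  unfolding U_large_def using U_branching_lists by (auto simp: branches_def)

lemma U_large_if_U_many_shifts_large:
  assumes A: "{\<alpha> \<in> K. U_large K U (seq_shift K Y [\<alpha>])} \<in> U"
  shows "U_large K U Y"
proof -
  define A where "A = {\<alpha> \<in> K. U_large K U (seq_shift K Y [\<alpha>])}"
  have "\<forall>\<alpha>\<in>A. \<exists>T. U_branching K U T \<and> branches K T \<subseteq> seq_shift K Y [\<alpha>]"
    by (simp add: A_def U_large_def)
  then obtain T where T: "\<And>\<alpha>. \<alpha> \<in> A \<Longrightarrow> U_branching K U (T \<alpha>)"
      "\<And>\<alpha>. \<alpha> \<in> A \<Longrightarrow> branches K (T \<alpha>) \<subseteq> seq_shift K Y [\<alpha>]"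
    by (metis (no_types))
  \<comment> \<open>\<open>S\<close> hangs each \<open>T \<alpha>\<close> above the node
    \<open>[\<alpha>]\<close>. The root is added separately, as all glued sequences are
    nonempty.\<close>
  define S where "S = insert [] {\<alpha> # \<tau> |\<alpha> \<tau>. \<alpha> \<in> A \<and> \<tau> \<in> T \<alpha>}"
  have Cons_S: "\<alpha> # \<tau> \<in> S \<longleftrightarrow> \<alpha> \<in> A \<and> \<tau> \<in> T \<alpha>" for \<alpha> \<tau>
    by (auto simp: S_def)
  have AK: "A \<subseteq> K"
    by (auto simp: A_def)
  have Nil_T: "[] \<in> T \<alpha>" if "\<alpha> \<in> A" for \<alpha>
    using T(1)[OF that] by (auto simp: U_branching_def)
  have tree_T: "seq_tree K (T \<alpha>)" if "\<alpha> \<in> A" for \<alpha>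
    using T(1)[OF that] by (simp add: U_branching_def)
  have "seq_tree K S"
    unfolding seq_tree_def
  proof (intro conjI ballI allI impI subsetI)
    fix \<sigma> assume \<sigma>: "\<sigma> \<in> S"
    show "\<sigma> \<in> lists K"
    proof (cases \<sigma>)
      case (Cons \<alpha> \<sigma>')
      then have "\<alpha> \<in> A" "\<sigma>' \<in> T \<alpha>"
        using \<sigma> by (simp_all add: Cons_S)
      then show ?thesis
        using Cons AK tree_T[of \<alpha>] by (auto simp: seq_tree_def)
    qed simp
    fix \<tau> assume \<tau>: "Sublist.prefix \<tau> \<sigma>"
    show "\<tau> \<in> S"
    proof (cases \<tau>)
      case Nil
      then show ?thesis
        by (simp add: S_def)
    next
      case (Cons \<alpha> \<tau>')
      then obtain \<sigma>' where \<sigma>': "\<sigma> = \<alpha> # \<sigma>'" "Sublist.prefix \<tau>' \<sigma>'"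
        using \<tau> by (cases \<sigma>) auto
      then have "\<alpha> \<in> A" "\<sigma>' \<in> T \<alpha>"
        using \<sigma> by (simp_all add: Cons_S)
      then show ?thesis
        using Cons \<sigma>'(2) tree_T[of \<alpha>] unfolding seq_tree_def by (simp add: Cons_S)
    qed
  qed
  \<comment> \<open>Every \<open>T \<alpha>\<close> contains its root, so the root of
    \<open>S\<close> has exactly \<open>A\<close> as its set of successors. A node
    \<open>\<alpha> # \<tau>\<close> has the same successors as \<open>\<tau>\<close> in
    \<open>T \<alpha>\<close>.\<close>
  moreover have "{\<alpha> \<in> K. \<sigma> @ [\<alpha>] \<in> S} \<in> U" if "\<sigma> \<in> S" for \<sigma>
  proof (cases \<sigma>)
    case Nil
    then have "{\<alpha> \<in> K. \<sigma> @ [\<alpha>] \<in> S} = A"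
      using AK Nil_T by (auto simp: Cons_S)
    then show ?thesis
      using A by (simp add: A_def)
  next
    case (Cons \<alpha> \<tau>)
    then show ?thesis
      using that T(1)[of \<alpha>] by (simp add: Cons_S U_branching_def)
  qed
  moreover have "[] \<in> S"
    by (simp add: S_def)
  ultimately have "U_branching K U S"
    by (simp add: U_branching_def)
  moreover have "s \<in> Y" if s: "s \<in> branches K S" for s
  proof -
    \<comment> \<open>Splitting off the first entry: any \<open>n\<close> gives
      \<open>s 0 \<in> A\<close>, and all \<open>n\<close> together make the tail a branch of
      \<open>T (s 0)\<close>.\<close>
    have "s 0 # map (s \<circ> Suc) [0..<n] \<in> S" for n
    proof -
      have "map s [0..<Suc n] \<in> S"
        using s unfolding branches_def by blast
      then show ?thesis
        by (simp add: map_upt_Suc comp_def del: upt_Suc)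
    qed
    then have "s 0 \<in> A" "s \<circ> Suc \<in> branches K (T (s 0))"
      using s by (auto simp: Cons_S branches_def)
    then have "[s 0] \<frown> (s \<circ> Suc) \<in> Y"
      using T(2)[of "s 0"] by (auto simp: seq_shift_def)
    moreover have "[s 0] \<frown> (s \<circ> Suc) = s"
      by (auto simp: conc_def fun_eq_iff)
    ultimately show ?thesis
      by simp
  qed
  ultimately show ?thesis
    unfolding U_large_def by blast
qed

text \<open>Topology enters only through \<open>op\<close>, the pointwise form of openness; the rest
  is combinatorics of the ultrafilter.\<close>

lemma U_small_if_not_U_large:
  assumes U: "ultrafilter_over K U"
    and Y: "Y \<subseteq> UNIV \<rightarrow> K" "\<not> U_large K U Y"
    and op: "\<And>s. s \<in> Y \<Longrightarrow> \<exists>n. UNIV \<rightarrow> K \<subseteq> seq_shift K Y (map s [0..<n])"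
  shows "U_small K U Y"
proof -
  define P where "P \<sigma> = U_large K U (seq_shift K Y \<sigma>)" for \<sigma>
  \<comment> \<open>Quantifying over all initial segments, and not just testing
    \<open>\<sigma>\<close>, makes \<open>T\<close> closed under initial segments by
    transitivity.\<close>
  define T where "T = {\<sigma> \<in> lists K. \<forall>\<tau>. Sublist.prefix \<tau> \<sigma> \<longrightarrow> \<not> P \<tau>}"
  have "seq_tree K T"
    unfolding seq_tree_def T_def in_lists_conv_set
    by (blast dest: set_mono_prefix intro: prefix_order.trans)
  moreover have "[] \<in> T"
    using Y by (auto simp: T_def P_def seq_shift_Nil)
  moreover have "{\<alpha> \<in> K. \<sigma> @ [\<alpha>] \<in> T} \<in> U" if \<sigma>: "\<sigma> \<in> T" for \<sigma>
  proof -
    have "\<not> P \<sigma>"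
      using \<sigma> by (auto simp: T_def)
    \<comment> \<open>The gluing lemma is applied to the shift of \<open>Y\<close> by
      \<open>\<sigma>\<close>.\<close>
    moreover have "P \<sigma>" if "{\<alpha> \<in> K. P (\<sigma> @ [\<alpha>])} \<in> U"
    proof -
      have "{\<alpha> \<in> K. P (\<sigma> @ [\<alpha>])} = {\<alpha> \<in> K. U_large K U (seq_shift K (seq_shift K Y \<sigma>) [\<alpha>])}"
        by (auto simp: P_def seq_shift_append)
      then show ?thesis
        using that U_large_if_U_many_shifts_large by (simp add: P_def)
    qed
    ultimately have "{\<alpha> \<in> K. P (\<sigma> @ [\<alpha>])} \<notin> U"
      by blast
    moreover have "{\<alpha> \<in> K. P (\<sigma> @ [\<alpha>])} \<subseteq> K"
      by blast
    \<comment> \<open>This is where the ultrafilter dichotomy is used.\<close>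
    ultimately have "K - {\<alpha> \<in> K. P (\<sigma> @ [\<alpha>])} \<in> U"
      using U unfolding ultrafilter_over_def by blast
    \<comment> \<open>Proper initial segments of \<open>\<sigma> @ [\<alpha>]\<close> are initial
      segments of \<open>\<sigma> \<in> T\<close>, so only the new node has to be tested.\<close>
    moreover have "{\<alpha> \<in> K. \<sigma> @ [\<alpha>] \<in> T} = K - {\<alpha> \<in> K. P (\<sigma> @ [\<alpha>])}"
      using \<sigma> by (auto simp: T_def)
    ultimately show ?thesis
      by simp
  qed
  ultimately have "U_branching K U T"
    by (auto simp: U_branching_def)
  moreover have "s \<notin> Y" if s: "s \<in> branches K T" for s
  proof
    assume "s \<in> Y"
    then obtain n where "UNIV \<rightarrow> K \<subseteq> seq_shift K Y (map s [0..<n])"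
      using op by blast
    then have "seq_shift K Y (map s [0..<n]) = (UNIV \<rightarrow> K)"
      by (auto simp: seq_shift_def)
    then have "P (map s [0..<n])"
      using U U_large_space[of K U] by (simp add: P_def ultrafilter_over_def)
    moreover have "map s [0..<n] \<in> T"
      using s by (simp add: branches_def)
    ultimately show False
      by (auto simp: T_def)
  qed
  ultimately show ?thesis
    unfolding U_small_def by blast
qed

theorem theorem5p5:
  fixes \<kappa> :: "'a rel" and U :: "'a set set" and X :: "(nat \<Rightarrow> 'a) set"
  assumes "Card_order \<kappa>"
    and "ultrafilter_over (Field \<kappa>) U"
    and "openin (seq_topology (Field \<kappa>)) X"
  shows "U_measurable (Field \<kappa>) U X"
  unfolding U_measurable_def U_determined_def
proof
  fix \<sigma> assume \<sigma>: "\<sigma> \<in> lists (Field \<kappa>)"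
  let ?K = "Field \<kappa>"
  let ?Y = "seq_shift ?K X \<sigma>"
  have Y: "?Y \<subseteq> UNIV \<rightarrow> ?K"
    by (auto simp: seq_shift_def)
  have "\<exists>n. UNIV \<rightarrow> ?K \<subseteq> seq_shift ?K ?Y (map s [0..<n])" if "s \<in> ?Y" for s
  proof -
    have s: "\<sigma> \<frown> s \<in> X" "s \<in> UNIV \<rightarrow> ?K"
      using that by (auto simp: seq_shift_def)
    \<comment> \<open>Here \<open>n\<close> counts coordinates of
      \<open>\<sigma> \<frown> s\<close>. Taking \<open>n\<close> entries of \<open>s\<close> after
      \<open>\<sigma>\<close> may fix more than needed, but avoids subtracting the length of
      \<open>\<sigma>\<close>.\<close>
    obtain n where n: "\<And>t. t \<in> UNIV \<rightarrow> ?K \<Longrightarrow> (\<And>i. i < n \<Longrightarrow> t i = (\<sigma> \<frown> s) i) \<Longrightarrow> t \<in> X"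
      using openin_seq_topology_imp_cylinder[OF assms(3) s(1)] by blast
    have m: "map s [0..<n] \<in> lists ?K"
      using s(2) by (auto simp: in_lists_conv_set)
    have "t \<in> seq_shift ?K ?Y (map s [0..<n])" if t: "t \<in> UNIV \<rightarrow> ?K" for t
    proof -
      have mt: "map s [0..<n] \<frown> t \<in> UNIV \<rightarrow> ?K"
        by (rule conc_in_funcset[OF m t])
      have "\<sigma> \<frown> (map s [0..<n] \<frown> t) \<in> X"
      proof (rule n)
        show "\<sigma> \<frown> (map s [0..<n] \<frown> t) \<in> UNIV \<rightarrow> ?K"
          by (rule conc_in_funcset[OF \<sigma> mt])
      qed (auto simp: conc_def)
      then show ?thesis
        using t mt by (simp add: seq_shift_def)
    qed
    then show ?thesis
      by blast
  qed
  then show "U_large ?K U ?Y \<or> U_small ?K U ?Y"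
    using U_small_if_not_U_large[OF assms(2), of ?Y] Y by blast
qed

end
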